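(* Let $A\in\mathbb{R}_+^{\infty\times\infty}$. Then $\mu(A)\le m(A)$ and $r'(A)\le r_{ess}(A)$. Consequently, $$r(A)=\max\{r_{ess}(A),\,m(A)\}.$$
   Context: $\mathbb{R}_+^{\infty\times\infty}$ is the set of infinite matrices $A=(a_{ij})_{i,j\in\mathbb{N}}$ with non-negative real entries and $\|A\|:=\sup\{a_{ij}:i,j\in\mathbb{N}\}<\infty$, where $\mathbb{N}=\{1,2,\dots\}$. $\ell^\infty_+$ is the set of bounded non-negative sequences with the sup norm, and $e_j$ is the $j$-th standard basis vector. In max algebra, $(A\otimes B)_{ij}=\sup_{k}a_{ik}b_{kj}$, $(A\otimes x)_i=\sup_j a_{ij}x_j$, and $A^k_\otimes$ is the $k$-th power of $A$ for $\otimes$. The max-algebra spectral radius is $r(A)=\lim_{k\to\infty}\|A^k_\otimes\|^{1/k}=\inf_k\|A^k_\otimes\|^{1/k}$ (the limit exists). The local spectral radius at $x\in\ell^\infty_+$ is $r_x(A)=\limsup_{k\to\infty}\|A^k_\otimes\otimes x\|^{1/k}$, and $m(A)=\sup_{j\in\mathbb{N}}r_{e_j}(A)$. For $n\in\mathbb{N}$, $P_n(x_1,x_2,\dots)=(0,\dots,0,x_{n+1},x_{n+2},\dots)$ (first $n$ coordinates replaced by $0$), so $P_nAP_n$ is $A$ with all entries having row or column index $\le n$ replaced by $0$; $r_{ess}(A)=\lim_{n\to\infty}r(P_nAP_n)=\inf_{n}r(P_nAP_n)$. For $i_0,\dots,i_k\in\mathbb{N}$ put $A(i_k,\dots,i_0)=\prod_{t=0}^{k-1}a_{i_{t+1}i_t}$.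 Define $$\mu(A)=\sup\{A(i_1,i_k,\dots,i_2,i_1)^{1/k}:k\in\mathbb{N},\ i_1,\dots,i_k\in\mathbb{N}\},$$ $$c_k(A)=\sup\{A(i_k,\dots,i_0): i_0,\dots,i_k\in\mathbb{N}\text{ mutually distinct}\},\qquad r'(A)=\limsup_{k\to\infty}c_k(A)^{1/k}.$$ *)

theory Defs
  imports "HOL-Analysis.Analysis"
begin

text \<open>
  Indices: the type \<^typ>\<open>nat\<close> plays the role of the index set \<open>{1, 2, \<dots>}\<close>, with \<open>j\<close> standing
  for the index \<open>j + 1\<close>. In particular the first \<open>n\<close> coordinates are those with \<open>j < n\<close>.
  Quantities given by a limsup (and suprema of such) are taken in \<^typ>\<open>ereal\<close>, where they
  always exist; suprema of type \<^typ>\<open>real\<close> are only meaningful for bounded families.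
\<close>

type_synonym infmat = "nat \<Rightarrow> nat \<Rightarrow> real"

definition bounded_nonneg_mats :: "infmat set" where
  "bounded_nonneg_mats =
     {A. (\<forall>i j. 0 \<le> A i j) \<and> bdd_above (range (\<lambda>(i, j). A i j))}"

definition mat_norm :: "infmat \<Rightarrow> real" where
  "mat_norm A = (SUP (i, j). A i j)"

definition seq_norm :: "(nat \<Rightarrow> real) \<Rightarrow> real" where
  "seq_norm x = (SUP j. \<bar>x j\<bar>)"

definition unit_seq :: "nat \<Rightarrow> nat \<Rightarrow> real" where
  "unit_seq j = (\<lambda>i. if i = j then 1 else 0)"

definition max_mult :: "infmat \<Rightarrow> infmat \<Rightarrow> infmat"  (infixl "\<otimes>\<^sub>m" 70) where
  "A \<otimes>\<^sub>m B = (\<lambda>i j. SUP k. A i k * B k j)"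

definition max_app :: "infmat \<Rightarrow> (nat \<Rightarrow> real) \<Rightarrow> (nat \<Rightarrow> real)"  (infixr "\<otimes>\<^sub>v" 70) where
  "A \<otimes>\<^sub>v x = (\<lambda>i. SUP j. A i j * x j)"

primrec max_pow :: "infmat \<Rightarrow> nat \<Rightarrow> infmat" where
  "max_pow A 0 = (\<lambda>i j. if i = j then 1 else 0)"
| "max_pow A (Suc k) = max_pow A k \<otimes>\<^sub>m A"

definition spec_rad :: "infmat \<Rightarrow> real" where
  "spec_rad A = lim (\<lambda>k. root k (mat_norm (max_pow A k)))"

definition local_spec_rad :: "infmat \<Rightarrow> (nat \<Rightarrow> real) \<Rightarrow> ereal" where
  "local_spec_rad A x = limsup (\<lambda>k. ereal (root k (seq_norm (max_pow A k \<otimes>\<^sub>v x))))"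

definition m_rad :: "infmat \<Rightarrow> ereal" where
  "m_rad A = (SUP j. local_spec_rad A (unit_seq j))"

text \<open>The matrix \<open>P\<^sub>n A P\<^sub>n\<close>.\<close>

definition tail_mat :: "nat \<Rightarrow> infmat \<Rightarrow> infmat" where
  "tail_mat n A = (\<lambda>i j. if i < n \<or> j < n then 0 else A i j)"

definition ess_spec_rad :: "infmat \<Rightarrow> real" where
  "ess_spec_rad A = lim (\<lambda>n. spec_rad (tail_mat n A))"

text \<open>
  \<open>path_weight A k i\<close> is \<open>A(i\<^sub>k, \<dots>, i\<^sub>0)\<close>; a tuple \<open>(i\<^sub>0, \<dots>, i\<^sub>k)\<close> is given by any
  function on \<^typ>\<open>nat\<close> extending it.
\<close>

definition path_weight :: "infmat \<Rightarrow> nat \<Rightarrow> (nat \<Rightarrow> nat) \<Rightarrow> real" where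
  "path_weight A k i = (\<Prod>t<k. A (i (Suc t)) (i t))"

text \<open>
  A cycle \<open>(i\<^sub>1, i\<^sub>k, \<dots>, i\<^sub>2, i\<^sub>1)\<close> is the path \<open>(i k, \<dots>, i 1, i 0)\<close> with \<open>i k = i 0\<close>.
\<close>

definition cycle_mean :: "infmat \<Rightarrow> ereal" where
  "cycle_mean A = Sup {ereal (root k (path_weight A k i)) | k i. 1 \<le> k \<and> i k = i 0}"

definition c_path :: "nat \<Rightarrow> infmat \<Rightarrow> real" where
  "c_path k A = Sup {path_weight A k i | i. inj_on i {..k}}"

definition r_path :: "infmat \<Rightarrow> ereal" where
  "r_path A = limsup (\<lambda>k. ereal (root k (c_path k A)))"

end

theory Submission
  imports Defs
begin

text \<open>
  The norm of the \<open>k\<close>-th max power is the supremum of the weights of paths of length \<open>k\<close>, so all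
  growth rates can be compared through exponential bounds \<open>C c\<^sup>k\<close> on path weights. A path is cut at
  its first visit to the finite set \<open>{0..<n}\<close>: the part before is a path of \<open>P\<^sub>n A P\<^sub>n\<close>, the
  part after starts at one of finitely many vertices. This gives \<open>r(A) \<le> max {r\<^sub>e\<^sub>s\<^sub>s(A), m(A)}\<close>
  directly; cutting repeatedly bounds the weight of a path that visits \<open>{0..<n}\<close> a bounded number
  of times, in particular of an injective path, which gives \<open>r'(A) \<le> r\<^sub>e\<^sub>s\<^sub>s(A)\<close>.
  Running around a cycle repeatedly gives \<open>\<mu>(A) \<le> m(A)\<close>.
\<close>

section \<open>Growth rates of sequences\<close>

text \<open>Only finitely many terms precede the threshold, and the constant absorbs them. A bound
  without exceptional indices can be applied to every piece of a cut path.\<close>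

lemma eventually_root_less_imp_bound:
  fixes u :: "nat \<Rightarrow> real"
  assumes "\<And>k. 0 \<le> u k" "0 < c" "\<forall>\<^sub>F k in sequentially. root k (u k) < c"
  obtains C where "0 < C" "\<And>k. u k \<le> C * c ^ k"
proof -
  obtain K where K: "\<And>k. k \<ge> K \<Longrightarrow> root k (u k) < c"
    using assms(3) by (auto simp: eventually_sequentially)
  \<comment> \<open>The sum dominates each ratio with \<open>k \<le> K\<close>; the summand 1 serves
    the later indices, where \<open>u k \<le> c ^ k\<close>.\<close>
  define C where "C = 1 + (\<Sum>k\<le>K. u k / c ^ k)"
  have nn: "0 \<le> u k / c ^ k" for k
    using assms by simp
  have C1: "1 \<le> C"
    unfolding C_def using nn by (simp add: sum_nonneg)
  have "u k \<le> C * c ^ k" for k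
  proof (cases "k \<le> K")
    case True
    then have "u k / c ^ k \<le> (\<Sum>k\<le>K. u k / c ^ k)"
      by (intro member_le_sum) (use nn in auto)
    then have "u k / c ^ k \<le> C"
      by (simp add: C_def)
    then show ?thesis
      using assms(2) by (simp add: divide_le_eq)
  next
    case False
    then have "root k (u k) ^ k \<le> c ^ k"
      using K[of k] assms(1) by (intro power_mono) auto
    then have "u k \<le> 1 * c ^ k"
      using False assms(1) by simp
    also have "\<dots> \<le> C * c ^ k"
      using C1 assms(2) by (intro mult_right_mono) auto
    finally show ?thesis .
  qed
  with C1 show ?thesis
    by (intro that[of C]) auto
qed

text \<open>Since \<open>root k C\<close> tends to 1, the constant disappears in the limit; the gap
  between \<open>c\<close> and \<open>d\<close> pays for it at finite \<open>k\<close>.\<close>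

lemma bound_imp_eventually_root_less:
  fixes u :: "nat \<Rightarrow> real"
  assumes "0 < C" "0 \<le> c" "c < d" "\<And>k. u k \<le> C * c ^ k"
  shows "\<forall>\<^sub>F k in sequentially. root k (u k) < d"
proof -
  have "(\<lambda>k. root k C * c) \<longlonglongrightarrow> 1 * c"
    by (intro tendsto_intros LIMSEQ_root_const assms)
  then have "\<forall>\<^sub>F k in sequentially. root k C * c < d"
    using assms(3) by (intro order_tendstoD) auto
  then show ?thesis
    using eventually_gt_at_top[of 0]
  proof eventually_elim
    case (elim k)
    have "root k (u k) \<le> root k (C * c ^ k)"
      using assms(4) elim by simp
    also have "\<dots> = root k C * c"
      using elim assms(2) by (simp add: real_root_mult real_root_power_cancel)
    finally show ?case
      using elim by simp
  qed
qed

lemma limsup_root_less_imp_bound: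
  fixes u :: "nat \<Rightarrow> real"
  assumes "\<And>k. 0 \<le> u k" "0 < c" "limsup (\<lambda>k. ereal (root k (u k))) < ereal c"
  obtains C where "0 < C" "\<And>k. u k \<le> C * c ^ k"
proof -
  have "\<forall>\<^sub>F k in sequentially. root k (u k) < c"
    using Limsup_lessD[OF assms(3)] by simp
  then show ?thesis
    using eventually_root_less_imp_bound[of u c] assms(1,2) that by blast
qed

lemma bound_imp_limsup_root_le:
  fixes u :: "nat \<Rightarrow> real"
  assumes "0 < C" "0 \<le> c" "\<And>k. u k \<le> C * c ^ k"
  shows "limsup (\<lambda>k. ereal (root k (u k))) \<le> ereal c"
proof (rule ccontr)
  assume "\<not> ?thesis"
  then obtain d where d: "ereal c < ereal d" "ereal d < limsup (\<lambda>k. ereal (root k (u k)))"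
    using ereal_dense2 by (metis not_le)
  have "\<forall>\<^sub>F k in sequentially. root k (u k) < d"
    using bound_imp_eventually_root_less[OF assms(1,2) _ assms(3)] d(1) by simp
  then have "limsup (\<lambda>k. ereal (root k (u k))) \<le> ereal d"
    by (intro Limsup_bounded) (auto elim: eventually_mono)
  with d(2) show False
    by simp
qed

text \<open>Fekete's lemma in multiplicative form: the limit is the infimum over positive indices.
  Division with remainder by one good index \<open>m\<close> replaces logarithms, so zero terms are
  allowed.\<close>

lemma submultiplicative_root_convergent:
  fixes u :: "nat \<Rightarrow> real"
  assumes nn: "\<And>k. 0 \<le> u k" and sub: "\<And>m n. u (m + n) \<le> u m * u n"
  shows "convergent (\<lambda>k. root k (u k))"
proof -
  \<comment> \<open>Index 0 is left out because \<open>root 0\<close> is constantly 0 and would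
    force the infimum to be 0.\<close>
  define R where "R = (INF k\<in>{1..}. root k (u k))"
  have bdd: "bdd_below ((\<lambda>k. root k (u k)) ` {1..})"
    by (intro bdd_belowI[of _ 0]) (use nn in auto)
  have R0: "0 \<le> R"
    unfolding R_def by (intro cINF_greatest) (use nn in auto)
  have "(\<lambda>k. root k (u k)) \<longlonglongrightarrow> R"
  proof (rule order_tendstoI)
    fix a assume a: "a < R"
    show "\<forall>\<^sub>F k in sequentially. a < root k (u k)"
      using eventually_ge_at_top[of 1]
    proof eventually_elim
      case (elim k)
      then have "R \<le> root k (u k)"
        unfolding R_def using bdd by (intro cINF_lower) auto
      with a show ?case
        by simp
    qed
  next
    fix d assume "R < d"
    \<comment> \<open>There is room on both sides: \<open>R < c\<close> supplies \<open>m\<close>,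
      and \<open>c < d\<close> absorbs the constant \<open>C\<close>.\<close>
    then obtain c where c: "R < c" "c < d"
      using dense by blast
    then obtain m where m: "m \<ge> 1" "root m (u m) < c"
      unfolding R_def using cINF_less_iff[OF _ bdd] by auto
    have "root m (u m) ^ m \<le> c ^ m"
      using m nn by (intro power_mono) auto
    then have um: "u m \<le> c ^ m"
      using m nn by simp
    have c0: "0 < c"
      using R0 c by simp
    have mult: "u (q * m + s) \<le> c ^ (q * m) * u s" for q s
    proof (induction q)
      case (Suc q)
      have "u (Suc q * m + s) \<le> u m * u (q * m + s)"
        using sub[of m "q * m + s"] by (simp add: add.assoc)
      also have "\<dots> \<le> c ^ m * (c ^ (q * m) * u s)"
        using um Suc nn c0 by (intro mult_mono) auto
      finally show ?case
        by (simp add: power_add mult.assoc)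
    qed simp
    \<comment> \<open>Only the remainders \<open>s < m\<close> of division by \<open>m\<close> have
      to be covered by the constant.\<close>
    define C where "C = 1 + (\<Sum>s<m. u s / c ^ s)"
    have nn': "0 \<le> u s / c ^ s" for s
      using nn c0 by simp
    have "u k \<le> C * c ^ k" for k
    proof -
      define s where "s = k mod m"
      define q where "q = k div m"
      have k: "k = q * m + s"
        by (simp add: q_def s_def)
      have "u s / c ^ s \<le> (\<Sum>s<m. u s / c ^ s)"
        by (intro member_le_sum) (use m nn' in \<open>auto simp: s_def\<close>)
      then have "u s \<le> C * c ^ s"
        using c0 by (simp add: C_def flip: pos_divide_le_eq)
      then have "c ^ (q * m) * u s \<le> c ^ (q * m) * (C * c ^ s)"
        using c0 by (intro mult_left_mono) auto
      with mult[of q s] show ?thesis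
        by (simp add: k power_add mult_ac)
    qed
    moreover have "0 < C"
      unfolding C_def using nn' by (simp add: add_pos_nonneg sum_nonneg)
    ultimately show "\<forall>\<^sub>F k in sequentially. root k (u k) < d"
      using bound_imp_eventually_root_less[of C c d u] c c0 by auto
  qed
  then show ?thesis
    by (auto simp: convergent_def)
qed

section \<open>Path weights and max powers\<close>

lemma bounded_nonneg_matsE:
  assumes "A \<in> bounded_nonneg_mats"
  obtains M where "1 \<le> M" "\<And>i j. 0 \<le> A i j" "\<And>i j. A i j \<le> M"
proof -
  obtain M where "\<forall>i j. A i j \<le> M"
    using assms unfolding bounded_nonneg_mats_def bdd_above_def by auto
  then have "A i j \<le> max 1 M" for i j
    by (simp add: le_max_iff_disj)
  then show ?thesis
    using assms by (intro that[of "max 1 M"]) (auto simp: bounded_nonneg_mats_def)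
qed

lemma bounded_nonneg_matsI:
  assumes "\<And>i j. 0 \<le> A i j" "\<And>i j. A i j \<le> M"
  shows "A \<in> bounded_nonneg_mats"
  using assms by (auto simp: bounded_nonneg_mats_def intro!: bdd_aboveI[of _ M])

lemma bounded_nonneg_mats_nonneg: "A \<in> bounded_nonneg_mats \<Longrightarrow> 0 \<le> A i j"
  by (simp add: bounded_nonneg_mats_def)

lemma path_weight_0 [simp]: "path_weight A 0 i = 1"
  by (simp add: path_weight_def)

lemma path_weight_Suc_first:
  "path_weight A (Suc k) i = path_weight A k (\<lambda>t. i (Suc t)) * A (i 1) (i 0)"
  unfolding path_weight_def by (simp add: prod.lessThan_Suc_shift mult.commute del: prod.lessThan_Suc)

lemma path_weight_Suc: "path_weight A (Suc k) i = A (i (Suc k)) (i k) * path_weight A k i"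
  by (simp add: path_weight_def)

lemma path_weight_add:
  "path_weight A (m + n) i = path_weight A m i * path_weight A n (\<lambda>t. i (m + t))"
  by (induction n) (simp_all add: path_weight_Suc mult_ac)

lemma path_weight_nonneg: "A \<in> bounded_nonneg_mats \<Longrightarrow> 0 \<le> path_weight A k i"
  unfolding path_weight_def by (intro prod_nonneg) (simp add: bounded_nonneg_mats_nonneg)

lemma path_weight_cong:
  "(\<And>t. t \<le> k \<Longrightarrow> i t = j t) \<Longrightarrow> path_weight A k i = path_weight A k j"
  unfolding path_weight_def by (intro prod.cong) auto

lemma path_weight_tail_mat:
  "(\<And>t. t \<le> k \<Longrightarrow> n \<le> i t) \<Longrightarrow> path_weight (tail_mat n A) k i = path_weight A k i"
  unfolding path_weight_def tail_mat_def by (intro prod.cong) (auto simp: leD Suc_leI)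

lemma path_weight_scale: "path_weight (\<lambda>i j. A i j / c) k i = path_weight A k i / c ^ k"
  by (simp add: path_weight_def prod_dividef)

lemma path_weight_mono:
  assumes "\<And>i j. 0 \<le> A i j" "\<And>i j. A i j \<le> B i j"
  shows "path_weight A k i \<le> path_weight B k i"
  unfolding path_weight_def using assms by (intro prod_mono) auto

text \<open>The upper bound makes the real suprema in \<open>max_mult\<close> meaningful. Both
  bounds share one induction because nonnegativity of the supremum relies on the family being
  bounded above.\<close>

lemma max_pow_bounds:
  assumes "\<And>i j. 0 \<le> A i j" "\<And>i j. A i j \<le> M"
  shows "0 \<le> max_pow A k i j \<and> max_pow A k i j \<le> M ^ k"
proof (induction k arbitrary: i j)
  case (Suc k)
  have le: "max_pow A k i l * A l j \<le> M ^ Suc k" for l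
    using mult_mono[OF conjunct2[OF Suc[of i l]] assms(2)[of l j]] Suc[of i l] assms
    by (force simp: mult.commute intro: order_trans)
  then have "bdd_above (range (\<lambda>l. max_pow A k i l * A l j))"
    by (auto intro!: bdd_aboveI)
  then have "max_pow A k i 0 * A 0 j \<le> (SUP l. max_pow A k i l * A l j)"
    by (intro cSUP_upper) auto
  moreover have "0 \<le> max_pow A k i 0 * A 0 j"
    using Suc assms by simp
  moreover have "(SUP l. max_pow A k i l * A l j) \<le> M ^ Suc k"
    using le by (intro cSUP_least) auto
  ultimately show ?case
    by (simp add: max_mult_def)
qed simp

text \<open>The entry is the supremum of the weights of paths of length \<open>k\<close> from
  \<open>b\<close> to \<open>a\<close>. Describing it by its upper bounds avoids the supremum of an
  empty family: for \<open>k = 0\<close> and \<open>a \<noteq> b\<close> there is no path and the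
  entry is 0, whence the condition on \<open>D\<close>.\<close>

lemma max_pow_le_iff:
  assumes A: "A \<in> bounded_nonneg_mats" and "0 \<le> D"
  shows "max_pow A k a b \<le> D \<longleftrightarrow> (\<forall>i. i 0 = b \<and> i k = a \<longrightarrow> path_weight A k i \<le> D)"
proof -
  obtain M where M: "1 \<le> M" "\<And>i j. 0 \<le> A i j" "\<And>i j. A i j \<le> M"
    using bounded_nonneg_matsE[OF A] by blast
  show ?thesis
    using assms(2)
  \<comment> \<open>The recursion multiplies by \<open>A\<close> on the right and so peels off the
    first step of a path. This changes the start \<open>b\<close>, and dividing by the weight of
    that step changes \<open>D\<close>.\<close>
  proof (induction k arbitrary: D b)
    case 0
    then show ?case
      by auto
  next
    case (Suc k)
    have "max_pow A k a l * A l b \<le> M ^ k * M" for l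
      using max_pow_bounds[of A M, OF M(2,3)] M by (intro mult_mono) (auto intro: order_trans)
    then have "bdd_above (range (\<lambda>l. max_pow A k a l * A l b))"
      by (auto intro!: bdd_aboveI)
    then have "max_pow A (Suc k) a b \<le> D \<longleftrightarrow> (\<forall>l. max_pow A k a l * A l b \<le> D)"
      by (simp add: max_mult_def cSUP_le_iff)
    also have "\<dots> \<longleftrightarrow> (\<forall>l i. i 0 = l \<and> i k = a \<longrightarrow> path_weight A k i * A l b \<le> D)"
    proof (intro iff_allI)
      fix l
      show "max_pow A k a l * A l b \<le> D \<longleftrightarrow>
        (\<forall>i. i 0 = l \<and> i k = a \<longrightarrow> path_weight A k i * A l b \<le> D)"
      \<comment> \<open>A step of weight 0 makes both sides true because \<open>0 \<le> D\<close>;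
        any other weight can be divided out.\<close>
      proof (cases "A l b = 0")
        case False
        then have "0 < A l b"
          using M(2)[of l b] by simp
        then show ?thesis
          using Suc.IH[of "D / A l b" l] Suc.prems by (simp add: pos_le_divide_eq)
      qed (use Suc.prems in simp)
    qed
    also have "\<dots> \<longleftrightarrow> (\<forall>i. i 0 = b \<and> i (Suc k) = a \<longrightarrow> path_weight A (Suc k) i \<le> D)"
    proof (intro iffI allI impI)
      fix i assume *: "\<forall>l i. i 0 = l \<and> i k = a \<longrightarrow> path_weight A k i * A l b \<le> D"
        and "i 0 = b \<and> i (Suc k) = a"
      then show "path_weight A (Suc k) i \<le> D"
        using *[rule_format, of "\<lambda>t. i (Suc t)" "i 1"] by (simp add: path_weight_Suc_first)
    next
      fix l i assume *: "\<forall>i. i 0 = b \<and> i (Suc k) = a \<longrightarrow> path_weight A (Suc k) i \<le> D"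
        and "i 0 = l \<and> i k = a"
      \<comment> \<open>The function \<open>case_nat b i\<close> is the path \<open>i\<close> with
        \<open>b\<close> put in front.\<close>
      then show "path_weight A k i * A l b \<le> D"
        using *[rule_format, of "case_nat b i"] by (simp add: path_weight_Suc_first)
    qed
    finally show ?case .
  qed
qed

lemma mat_norm_max_pow_le_iff:
  assumes A: "A \<in> bounded_nonneg_mats"
  shows "mat_norm (max_pow A k) \<le> D \<longleftrightarrow> (\<forall>i. path_weight A k i \<le> D)"
proof -
  obtain M where M: "1 \<le> M" "\<And>i j. 0 \<le> A i j" "\<And>i j. A i j \<le> M"
    using bounded_nonneg_matsE[OF A] by blast
  note b = max_pow_bounds[of A M, OF M(2,3)]
  have "bdd_above (range (\<lambda>(i, j). max_pow A k i j))"
    using b by (auto intro!: bdd_aboveI[of _ "M ^ k"])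
  then have iff: "mat_norm (max_pow A k) \<le> D \<longleftrightarrow> (\<forall>i j. max_pow A k i j \<le> D)"
    unfolding mat_norm_def by (subst cSUP_le_iff) auto
  show ?thesis
  proof (cases "0 \<le> D")
    case True
    then show ?thesis
      by (auto simp: iff max_pow_le_iff[OF A])
  next
    case False
    \<comment> \<open>A negative \<open>D\<close> fails on both sides: with free endpoints there is
      a path of every length, and weights and entries are nonnegative.\<close>
    then have "\<not> max_pow A k 0 0 \<le> D" "\<not> path_weight A k (\<lambda>_. 0) \<le> D"
      using b[of k 0 0] path_weight_nonneg[OF A, of k "\<lambda>_. 0"] by linarith+
    then show ?thesis
      by (auto simp: iff)
  qed
qed

text \<open>Applying a matrix to a unit sequence extracts a column, which fixes the start of the
  paths and leaves their end free.\<close>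

lemma seq_norm_max_pow_le_iff:
  assumes A: "A \<in> bounded_nonneg_mats"
  shows "seq_norm (max_pow A k \<otimes>\<^sub>v unit_seq j) \<le> D \<longleftrightarrow> (\<forall>i. i 0 = j \<longrightarrow> path_weight A k i \<le> D)"
proof -
  obtain M where M: "1 \<le> M" "\<And>i j. 0 \<le> A i j" "\<And>i j. A i j \<le> M"
    using bounded_nonneg_matsE[OF A] by blast
  note b = max_pow_bounds[of A M, OF M(2,3)]
  have col: "(max_pow A k \<otimes>\<^sub>v unit_seq j) i = max_pow A k i j" for i
    unfolding max_app_def unit_seq_def
    \<comment> \<open>The supremum is attained at index \<open>j\<close>: all other terms are 0 and
      the entries are nonnegative.\<close>
    by (rule cSup_eq_maximum) (use b in \<open>auto intro!: image_eqI[of _ _ j]\<close>)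
  have "bdd_above (range (\<lambda>i. \<bar>(max_pow A k \<otimes>\<^sub>v unit_seq j) i\<bar>))"
    using b by (auto intro!: bdd_aboveI[of _ "M ^ k"] simp: col)
  then have iff: "seq_norm (max_pow A k \<otimes>\<^sub>v unit_seq j) \<le> D \<longleftrightarrow> (\<forall>i. max_pow A k i j \<le> D)"
    unfolding seq_norm_def by (subst cSUP_le_iff) (use b in \<open>auto simp: col\<close>)
  show ?thesis
  proof (cases "0 \<le> D")
    case True
    then show ?thesis
      by (auto simp: iff max_pow_le_iff[OF A])
  next
    case False
    then have "\<not> max_pow A k 0 j \<le> D" "\<not> path_weight A k (\<lambda>_. j) \<le> D"
      using b[of k 0 j] path_weight_nonneg[OF A, of k "\<lambda>_. j"] by linarith+
    then show ?thesis
      by (auto simp: iff)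
  qed
qed

lemma path_weight_le_mat_norm:
  "A \<in> bounded_nonneg_mats \<Longrightarrow> path_weight A k i \<le> mat_norm (max_pow A k)"
  using mat_norm_max_pow_le_iff by blast

lemma path_weight_le_seq_norm:
  "A \<in> bounded_nonneg_mats \<Longrightarrow> path_weight A k i \<le> seq_norm (max_pow A k \<otimes>\<^sub>v unit_seq (i 0))"
  using seq_norm_max_pow_le_iff by blast

lemma mat_norm_nonneg: "A \<in> bounded_nonneg_mats \<Longrightarrow> 0 \<le> mat_norm (max_pow A k)"
  using path_weight_le_mat_norm path_weight_nonneg order_trans by meson

lemma seq_norm_nonneg:
  "A \<in> bounded_nonneg_mats \<Longrightarrow> 0 \<le> seq_norm (max_pow A k \<otimes>\<^sub>v unit_seq j)"
  using path_weight_le_seq_norm[of A k "\<lambda>_. j"] path_weight_nonneg[of A k "\<lambda>_. j"] by linarith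

section \<open>Spectral radii\<close>

text \<open>A path of length \<open>m + n\<close> splits into two paths, so the norms of the powers
  are submultiplicative and \<open>lim\<close> denotes a genuine limit.\<close>

lemma spec_rad_LIMSEQ:
  assumes A: "A \<in> bounded_nonneg_mats"
  shows "(\<lambda>k. root k (mat_norm (max_pow A k))) \<longlonglongrightarrow> spec_rad A"
proof -
  have "mat_norm (max_pow A (m + n)) \<le> mat_norm (max_pow A m) * mat_norm (max_pow A n)" for m n
    unfolding mat_norm_max_pow_le_iff[OF A] path_weight_add
    using A by (auto intro!: mult_mono path_weight_le_mat_norm path_weight_nonneg mat_norm_nonneg)
  then show ?thesis
    unfolding spec_rad_def convergent_LIMSEQ_iff[symmetric]
    by (intro submultiplicative_root_convergent mat_norm_nonneg A)
qed

lemma spec_rad_nonneg: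
  assumes "A \<in> bounded_nonneg_mats"
  shows "0 \<le> spec_rad A"
  by (rule LIMSEQ_le_const[OF spec_rad_LIMSEQ[OF assms]])
    (use mat_norm_nonneg[OF assms] in \<open>auto intro: real_root_ge_zero\<close>)

lemma spec_rad_less_imp_bound:
  assumes A: "A \<in> bounded_nonneg_mats" and "spec_rad A < c"
  obtains C where "0 < C" "\<And>k i. path_weight A k i \<le> C * c ^ k"
proof -
  have "0 < c"
    using spec_rad_nonneg[OF A] assms(2) by simp
  then obtain C where "0 < C" "\<And>k. mat_norm (max_pow A k) \<le> C * c ^ k"
    using eventually_root_less_imp_bound[of "\<lambda>k. mat_norm (max_pow A k)" c]
      order_tendstoD(2)[OF spec_rad_LIMSEQ[OF A] assms(2)] mat_norm_nonneg[OF A] by blast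
  then show ?thesis
    using that mat_norm_max_pow_le_iff[OF A] by blast
qed

lemma bound_imp_spec_rad_le:
  assumes A: "A \<in> bounded_nonneg_mats" and "0 < C" "0 \<le> c" "\<And>k i. path_weight A k i \<le> C * c ^ k"
  shows "spec_rad A \<le> c"
proof (rule dense_ge)
  fix d assume "c < d"
  then have "\<forall>\<^sub>F k in sequentially. root k (mat_norm (max_pow A k)) < d"
    using bound_imp_eventually_root_less[of C c d "\<lambda>k. mat_norm (max_pow A k)"] assms
    by (simp add: mat_norm_max_pow_le_iff)
  then show "spec_rad A \<le> d"
    by (intro tendsto_upperbound[OF spec_rad_LIMSEQ[OF A]]) (auto elim: eventually_mono)
qed

lemma local_spec_rad_less_imp_bound:
  assumes A: "A \<in> bounded_nonneg_mats" and "0 < c" "local_spec_rad A (unit_seq j) < ereal c"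
  obtains C where "0 < C" "\<And>k i. i 0 = j \<Longrightarrow> path_weight A k i \<le> C * c ^ k"
proof -
  obtain C where "0 < C" "\<And>k. seq_norm (max_pow A k \<otimes>\<^sub>v unit_seq j) \<le> C * c ^ k"
    using limsup_root_less_imp_bound[OF seq_norm_nonneg[OF A] assms(2) assms(3)[unfolded local_spec_rad_def]]
    by blast
  then show ?thesis
    using that seq_norm_max_pow_le_iff[OF A] by blast
qed

lemma m_rad_le_spec_rad:
  assumes A: "A \<in> bounded_nonneg_mats"
  shows "m_rad A \<le> ereal (spec_rad A)"
  unfolding m_rad_def local_spec_rad_def
proof (rule SUP_least)
  fix j
  have le: "seq_norm (max_pow A k \<otimes>\<^sub>v unit_seq j) \<le> mat_norm (max_pow A k)" for k
    using path_weight_le_mat_norm[OF A] by (simp add: seq_norm_max_pow_le_iff[OF A])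
  have "limsup (\<lambda>k. ereal (root k (seq_norm (max_pow A k \<otimes>\<^sub>v unit_seq j))))
      \<le> limsup (\<lambda>k. ereal (root k (mat_norm (max_pow A k))))"
    by (intro Limsup_mono eventually_mono[OF eventually_gt_at_top[of 0]]) (simp add: le)
  also have "\<dots> = ereal (spec_rad A)"
    using spec_rad_LIMSEQ[OF A] by (intro lim_imp_Limsup) auto
  finally show "limsup (\<lambda>k. ereal (root k (seq_norm (max_pow A k \<otimes>\<^sub>v unit_seq j))))
    \<le> ereal (spec_rad A)" .
qed

text \<open>Every exponential bound for the paths of \<open>B\<close> is inherited by those of
  \<open>A\<close>. The use is to compare truncations with each other and with the full
  matrix.\<close>

lemma spec_rad_mono:
  assumes B: "B \<in> bounded_nonneg_mats" and "\<And>i j. 0 \<le> A i j" "\<And>i j. A i j \<le> B i j"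
  shows "spec_rad A \<le> spec_rad B"
proof (rule dense_ge)
  obtain M where "1 \<le> M" "\<And>i j. 0 \<le> B i j" "\<And>i j. B i j \<le> M"
    using bounded_nonneg_matsE[OF B] by blast
  then have A: "A \<in> bounded_nonneg_mats"
    by (intro bounded_nonneg_matsI[of A M] assms(2) order_trans[OF assms(3)])
  fix c assume c: "spec_rad B < c"
  obtain C where "0 < C" "\<And>k i. path_weight B k i \<le> C * c ^ k"
    using spec_rad_less_imp_bound[OF B c] by blast
  then show "spec_rad A \<le> c"
    using spec_rad_nonneg[OF B] c
    by (intro bound_imp_spec_rad_le[OF A, of C c] order_trans[OF path_weight_mono[of A B, OF assms(2,3)]]) auto
qed

lemma tail_mat_bounded_nonneg:
  assumes A: "A \<in> bounded_nonneg_mats"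
  shows "tail_mat n A \<in> bounded_nonneg_mats"
proof -
  obtain M where "1 \<le> M" "\<And>i j. 0 \<le> A i j" "\<And>i j. A i j \<le> M"
    using bounded_nonneg_matsE[OF A] by blast
  then show ?thesis
    by (intro bounded_nonneg_matsI[of _ M]) (auto simp: tail_mat_def)
qed

text \<open>Truncating further lowers the entries, so the radii form a decreasing sequence bounded
  below by 0.\<close>

lemma ess_spec_rad_LIMSEQ:
  assumes A: "A \<in> bounded_nonneg_mats"
  shows "(\<lambda>n. spec_rad (tail_mat n A)) \<longlonglongrightarrow> ess_spec_rad A"
proof -
  have "spec_rad (tail_mat n A) \<le> spec_rad (tail_mat m A)" if "m \<le> n" for m n
    using that A
    by (intro spec_rad_mono tail_mat_bounded_nonneg) (auto simp: tail_mat_def bounded_nonneg_mats_nonneg)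
  then have "decseq (\<lambda>n. spec_rad (tail_mat n A))"
    by (simp add: decseq_def)
  then have "convergent (\<lambda>n. spec_rad (tail_mat n A))"
    using decseq_convergent[of "\<lambda>n. spec_rad (tail_mat n A)" 0]
    by (metis A convergentI spec_rad_nonneg tail_mat_bounded_nonneg)
  then show ?thesis
    by (simp add: ess_spec_rad_def convergent_LIMSEQ_iff)
qed

lemma ess_spec_rad_nonneg: "A \<in> bounded_nonneg_mats \<Longrightarrow> 0 \<le> ess_spec_rad A"
  by (rule LIMSEQ_le_const[OF ess_spec_rad_LIMSEQ])
    (auto intro: spec_rad_nonneg tail_mat_bounded_nonneg)

lemma ess_spec_rad_le_spec_rad:
  assumes A: "A \<in> bounded_nonneg_mats"
  shows "ess_spec_rad A \<le> spec_rad A"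
proof -
  have "spec_rad (tail_mat n A) \<le> spec_rad A" for n
    using A by (intro spec_rad_mono) (auto simp: tail_mat_def bounded_nonneg_mats_nonneg)
  then show ?thesis
    using LIMSEQ_le_const2[OF ess_spec_rad_LIMSEQ[OF A]] by blast
qed

lemma ess_spec_rad_less_imp_bound:
  assumes A: "A \<in> bounded_nonneg_mats" and c: "ess_spec_rad A < c"
  obtains n C where "0 < C" "\<And>k i. path_weight (tail_mat n A) k i \<le> C * c ^ k"
proof -
  obtain n where "spec_rad (tail_mat n A) < c"
    using order_tendstoD(2)[OF ess_spec_rad_LIMSEQ[OF A] c] by (auto simp: eventually_sequentially)
  then show ?thesis
    using spec_rad_less_imp_bound[OF tail_mat_bounded_nonneg[OF A]] that by blast
qed

section \<open>Cutting paths at visits to a finite set\<close>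

text \<open>Before the first visit all vertices lie outside \<open>{0..<n}\<close>, so that part is
  a path of the truncated matrix and contributes at most \<open>C\<close>. The edge entering the set
  is erased by the truncation and costs a separate factor \<open>M\<close>.\<close>

lemma path_weight_first_visit:
  assumes nn: "\<And>i j. 0 \<le> A i j" and le: "\<And>i j. A i j \<le> M" and M: "1 \<le> M" and C: "1 \<le> C"
    and tail: "\<And>k i. path_weight (tail_mat n A) k i \<le> C"
    and visit: "\<exists>t\<le>k. i t < n"
  obtains t where "t \<le> k" "i t < n"
    "path_weight A k i \<le> C * M * path_weight A (k - t) (\<lambda>s. i (t + s))"
proof -
  define t where "t = (LEAST t. i t < n)"
  have t: "t \<le> k" "i t < n"
    using visit by (auto simp: t_def intro: LeastI Least_le order_trans)
  have before: "n \<le> i s" if "s < t" for s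
    using not_less_Least[OF that[unfolded t_def]] by simp
  have prefix: "path_weight A t i \<le> C * M"
  proof (cases t)
    case 0
    then show ?thesis
      using mult_mono[of 1 C 1 M] C M by simp
  next
    case (Suc s)
    then have "path_weight A s i \<le> C"
      using tail[of s i] before by (subst (asm) path_weight_tail_mat) auto
    then have "A (i (Suc s)) (i s) * path_weight A s i \<le> M * C"
      using nn le C M by (intro mult_mono) (auto simp: path_weight_def intro!: prod_nonneg)
    then show ?thesis
      by (simp add: Suc path_weight_Suc mult.commute)
  qed
  have "path_weight A k i = path_weight A t i * path_weight A (k - t) (\<lambda>s. i (t + s))"
    using path_weight_add[of A t "k - t" i] t by simp
  also have "\<dots> \<le> C * M * path_weight A (k - t) (\<lambda>s. i (t + s))"
    using prefix nn by (intro mult_right_mono) (auto simp: path_weight_def intro!: prod_nonneg)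
  finally show ?thesis
    using t that by blast
qed

text \<open>Each visit costs a factor \<open>C * M * M\<close>: \<open>C * M\<close> for the part up
  to and including the entering edge, and \<open>M\<close> for the leaving edge. The extra
  \<open>C\<close> pays for the part after the last visit.\<close>

lemma path_weight_few_visits:
  assumes nn: "\<And>i j. 0 \<le> A i j" and le: "\<And>i j. A i j \<le> M" and M: "1 \<le> M" and C: "1 \<le> C"
    and tail: "\<And>k i. path_weight (tail_mat n A) k i \<le> C"
  shows "card {t. t \<le> k \<and> i t < n} \<le> b \<Longrightarrow> path_weight A k i \<le> C * (C * M * M) ^ b"
proof (induction b arbitrary: k i)
  case 0
  then have "n \<le> i t" if "t \<le> k" for t
    using that by (auto simp: not_less)
  then show ?case
    using tail[of k i] by (simp add: path_weight_tail_mat)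
next
  case (Suc b)
  have CM: "1 \<le> C * M"
    using mult_mono[of 1 C 1 M] C M by simp
  then have CMM: "1 \<le> C * M * M"
    using mult_mono[of 1 "C * M" 1 M] M by simp
  have one: "1 \<le> C * (C * M * M) ^ b"
    using mult_mono[of 1 C 1 "(C * M * M) ^ b"] C one_le_power[OF CMM] by simp
  show ?case
  proof (cases "\<exists>t\<le>k. i t < n")
    case False
    then have "path_weight A k i \<le> C * 1"
      using tail[of k i] by (simp add: path_weight_tail_mat not_less)
    also have "\<dots> \<le> C * (C * M * M) ^ Suc b"
      using one_le_power[OF CMM, of "Suc b"] C by (intro mult_left_mono) auto
    finally show ?thesis .
  next
    case True
    then obtain t where t: "t \<le> k" "i t < n"
      and w: "path_weight A k i \<le> C * M * path_weight A (k - t) (\<lambda>s. i (t + s))"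
      using path_weight_first_visit[of A M C n k i, OF nn le M C tail] by blast
    have "path_weight A (k - t) (\<lambda>s. i (t + s)) \<le> M * (C * (C * M * M) ^ b)"
    proof (cases "k - t")
      case 0
      then show ?thesis
        using mult_mono[of 1 M 1, OF M one] M by simp
    next
      case (Suc r)
      \<comment> \<open>Starting one vertex after \<open>t\<close> drops the visit at
        \<open>t\<close> from the count, so the induction hypothesis applies.\<close>
      define j where "j = (\<lambda>s. i (t + Suc s))"
      have "(\<lambda>s. t + Suc s) ` {s. s \<le> r \<and> j s < n} \<subseteq> {s. s \<le> k \<and> i s < n} - {t}"
        using Suc by (auto simp: j_def)
      then have "card ((\<lambda>s. t + Suc s) ` {s. s \<le> r \<and> j s < n}) \<le> card ({s. s \<le> k \<and> i s < n} - {t})"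
        by (intro card_mono) auto
      also have "\<dots> \<le> b"
        using Suc.prems t by (subst card_Diff_singleton) auto
      finally have "path_weight A r j \<le> C * (C * M * M) ^ b"
        by (intro Suc.IH) (simp add: card_image inj_on_def)
      then have "path_weight A r j * A (i (t + 1)) (i t) \<le> C * (C * M * M) ^ b * M"
        using nn le M one by (intro mult_mono) auto
      then show ?thesis
        by (simp add: Suc path_weight_Suc_first j_def mult_ac)
    qed
    then have "C * M * path_weight A (k - t) (\<lambda>s. i (t + s)) \<le> C * M * (M * (C * (C * M * M) ^ b))"
      using CM by (intro mult_left_mono) auto
    with w show ?thesis
      by (simp add: mult_ac)
  qed
qed

text \<open>Dividing the entries by \<open>c\<close> turns exponential bounds \<open>C c\<^sup>k\<close> into uniform ones.\<close>

lemma scaled_tail_boundE: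
  assumes A: "A \<in> bounded_nonneg_mats" and c: "ess_spec_rad A < c"
  obtains n C M where "1 \<le> M" "1 \<le> C"
    "\<And>i j. 0 \<le> A i j / c" "\<And>i j. A i j / c \<le> M"
    "\<And>k i. path_weight (tail_mat n (\<lambda>i j. A i j / c)) k i \<le> C"
proof -
  have c0: "0 < c"
    using ess_spec_rad_nonneg[OF A] c by simp
  obtain n C where C: "0 < C" "\<And>k i. path_weight (tail_mat n A) k i \<le> C * c ^ k"
    using ess_spec_rad_less_imp_bound[OF A c] by metis
  obtain M where M: "1 \<le> M" "\<And>i j. 0 \<le> A i j" "\<And>i j. A i j \<le> M"
    using bounded_nonneg_matsE[OF A] by blast
  have "tail_mat n (\<lambda>i j. A i j / c) = (\<lambda>i j. tail_mat n A i j / c)"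
    by (auto simp: tail_mat_def fun_eq_iff)
  \<comment> \<open>Constants are raised to at least 1, as the cutting lemmas require.\<close>
  then have "path_weight (tail_mat n (\<lambda>i j. A i j / c)) k i \<le> max 1 C" for k i
    using C(2)[of k i] c0 by (simp add: path_weight_scale divide_le_eq le_max_iff_disj)
  moreover have "A i j / c \<le> max 1 (M / c)" for i j
    using M(3)[of i j] c0 by (simp add: divide_right_mono le_max_iff_disj)
  ultimately show ?thesis
    using that[of "max 1 (M / c)" "max 1 C" n] M(2) c0 by simp
qed

section \<open>Comparison of the radii with each other and with path and cycle quantities\<close>

lemma r_path_le_ess_spec_rad:
  assumes A: "A \<in> bounded_nonneg_mats"
  shows "r_path A \<le> ereal (ess_spec_rad A)"
proof (rule ccontr)
  assume "\<not> ?thesis"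
  then obtain c where c: "ess_spec_rad A < c" "ereal c < r_path A"
    using ereal_dense2 by (metis not_le less_ereal.simps(1))
  have c0: "0 < c"
    using ess_spec_rad_nonneg[OF A] c by simp
  obtain n C M where b: "1 \<le> M" "1 \<le> C" "\<And>i j. 0 \<le> A i j / c" "\<And>i j. A i j / c \<le> M"
    "\<And>k i. path_weight (tail_mat n (\<lambda>i j. A i j / c)) k i \<le> C"
    using scaled_tail_boundE[OF A c(1)] by metis
  define D where "D = C * (C * M * M) ^ n"
  have "path_weight A k i \<le> D * c ^ k" if inj: "inj_on i {..k}" for k i
  proof -
    \<comment> \<open>An injective path maps its visiting times injectively into
      \<open>{..<n}\<close>, so the number of visits, and with it \<open>D\<close>, does not depend
      on \<open>k\<close>.\<close>
    have "card {t. t \<le> k \<and> i t < n} \<le> card {..<n}"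
      using inj by (intro card_inj_on_le[of i]) (auto simp: inj_on_def)
    then have "path_weight (\<lambda>i j. A i j / c) k i \<le> D"
      unfolding D_def using path_weight_few_visits[of "\<lambda>i j. A i j / c" M C n k i n, OF b(3,4,1,2,5)] by simp
    then show ?thesis
      using c0 by (simp add: path_weight_scale divide_le_eq)
  qed
  \<comment> \<open>The identity is an injective path of every length, so the supremum is over a
    nonempty set.\<close>
  then have "c_path k A \<le> D * c ^ k" for k
    unfolding c_path_def by (intro cSup_least) (auto intro: exI[of _ "\<lambda>t. t"])
  moreover have "0 < D"
    using b by (simp add: D_def)
  ultimately have "r_path A \<le> ereal c"
    unfolding r_path_def using c0 by (intro bound_imp_limsup_root_le) auto
  with c show False
    by simp
qed

text \<open>One cut suffices: the local radius at the first visited vertex controls all paths from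
  there on, however often they return to the set.\<close>

lemma spec_rad_le_max:
  assumes A: "A \<in> bounded_nonneg_mats"
  shows "ereal (spec_rad A) \<le> max (ereal (ess_spec_rad A)) (m_rad A)"
proof (rule ccontr)
  assume "\<not> ?thesis"
  then obtain c where c: "ess_spec_rad A < c" "m_rad A < ereal c" "c < spec_rad A"
    using ereal_dense2[of "max (ereal (ess_spec_rad A)) (m_rad A)" "ereal (spec_rad A)"]
    by (auto simp: not_le)
  have c0: "0 < c"
    using ess_spec_rad_nonneg[OF A] c by simp
  obtain n C M where b: "1 \<le> M" "1 \<le> C" "\<And>i j. 0 \<le> A i j / c" "\<And>i j. A i j / c \<le> M"
    "\<And>k i. path_weight (tail_mat n (\<lambda>i j. A i j / c)) k i \<le> C"
    using scaled_tail_boundE[OF A c(1)] by metis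
  have "\<exists>E>0. \<forall>k i. i 0 = j \<longrightarrow> path_weight A k i \<le> E * c ^ k" for j
  proof -
    have "local_spec_rad A (unit_seq j) < ereal c"
      using c(2) unfolding m_rad_def by (meson SUP_upper UNIV_I le_less_trans)
    then show ?thesis
      using local_spec_rad_less_imp_bound[OF A c0] by metis
  qed
  then obtain E where E: "\<And>j. 0 < E j" "\<And>k i. path_weight A k i \<le> E (i 0) * c ^ k"
    by metis
  \<comment> \<open>Finitely many start vertices \<open>j < n\<close> admit a common constant; the
    summand 1 makes it serve the paths without visits too.\<close>
  define F where "F = 1 + (\<Sum>j<n. E j)"
  have EF: "E j \<le> F" if "j < n" for j
    using that member_le_sum[of j "{..<n}" E] E(1) by (auto simp: F_def less_imp_le add_increasing)
  have F1: "1 \<le> F"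
    unfolding F_def using E(1) by (simp add: sum_nonneg less_imp_le)
  have CM: "0 \<le> C * M"
    using b by simp
  have "path_weight (\<lambda>i j. A i j / c) k i \<le> C * M * F" for k i
  proof (cases "\<exists>t\<le>k. i t < n")
    case False
    then have "path_weight (\<lambda>i j. A i j / c) k i \<le> C"
      using b(5)[of k i] by (simp add: path_weight_tail_mat not_less)
    also have "\<dots> = C * 1 * 1"
      by simp
    also have "\<dots> \<le> C * M * F"
      using b F1 by (intro mult_mono) auto
    finally show ?thesis .
  next
    case True
    then obtain t where t: "t \<le> k" "i t < n" and w: "path_weight (\<lambda>i j. A i j / c) k i
        \<le> C * M * path_weight (\<lambda>i j. A i j / c) (k - t) (\<lambda>s. i (t + s))"
      using path_weight_first_visit[of "\<lambda>i j. A i j / c" M C n k i, OF b(3,4,1,2,5)] by blast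
    have "path_weight (\<lambda>i j. A i j / c) (k - t) (\<lambda>s. i (t + s)) \<le> E (i t)"
      using E(2)[of "k - t" "\<lambda>s. i (t + s)"] c0 by (simp add: path_weight_scale divide_le_eq)
    also have "\<dots> \<le> F"
      using EF t by simp
    finally have "C * M * path_weight (\<lambda>i j. A i j / c) (k - t) (\<lambda>s. i (t + s)) \<le> C * M * F"
      using CM by (intro mult_left_mono) auto
    with w show ?thesis
      by simp
  qed
  then have "path_weight A k i \<le> C * M * F * c ^ k" for k i
    using c0 by (simp add: path_weight_scale divide_le_eq)
  moreover have "0 < C * M * F"
    using b F1 by simp
  ultimately have "spec_rad A \<le> c"
    using c0 by (intro bound_imp_spec_rad_le[OF A]) auto
  with c show False
    by simp
qed

text \<open>The cycle run \<open>q\<close> times has length \<open>k * q\<close> and weight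
  \<open>p ^ q\<close>, so the local radius at its start is at least \<open>root k p\<close>,
  already along the multiples of \<open>k\<close>.\<close>

lemma cycle_mean_le_m_rad:
  assumes A: "A \<in> bounded_nonneg_mats"
  shows "cycle_mean A \<le> m_rad A"
  unfolding cycle_mean_def
proof (rule Sup_least, clarify)
  fix k and i :: "nat \<Rightarrow> nat"
  assume k: "1 \<le> k" "i k = i 0"
  define p where "p = path_weight A k i"
  define v where "v = (\<lambda>q. ereal (root q (seq_norm (max_pow A q \<otimes>\<^sub>v unit_seq (i 0)))))"
  define j where "j = (\<lambda>t. i (t mod k))"
  have p0: "0 \<le> p"
    by (simp add: p_def path_weight_nonneg[OF A])
  \<comment> \<open>At \<open>t = k\<close> the two paths agree because the cycle is closed:
    \<open>j k = i 0 = i k\<close>.\<close>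
  have once: "path_weight A k j = p"
    unfolding p_def by (rule path_weight_cong) (use k in \<open>auto simp: j_def le_less\<close>)
  have "path_weight A (k * q) j = p ^ q" for q
  proof (induction q)
    case (Suc q)
    have "path_weight A (k * Suc q) j = path_weight A k j * path_weight A (k * q) (\<lambda>t. j (k + t))"
      by (simp add: path_weight_add)
    also have "(\<lambda>t. j (k + t)) = j"
      by (simp add: j_def)
    finally show ?case
      using Suc once by simp
  qed simp
  then have le: "p ^ q \<le> seq_norm (max_pow A (k * q) \<otimes>\<^sub>v unit_seq (i 0))" for q
    using path_weight_le_seq_norm[OF A, of "k * q" j] by (simp add: j_def)
  have "ereal (root k p) \<le> v (k * q)" if "0 < q" for q
  proof -
    have "root k p = root (k * q) (p ^ q)"
      using that p0 by (simp add: real_root_mult_exp real_root_power_cancel)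
    also have "\<dots> \<le> root (k * q) (seq_norm (max_pow A (k * q) \<otimes>\<^sub>v unit_seq (i 0)))"
      using le that k by simp
    finally show ?thesis
      by (simp add: v_def)
  qed
  then have "ereal (root k p) \<le> limsup (v \<circ> (\<lambda>q. k * q))"
    by (intro le_Limsup) (auto intro!: eventually_mono[OF eventually_gt_at_top[of 0]])
  also have "\<dots> \<le> limsup v"
    using k by (intro limsup_subseq_mono) (simp add: strict_mono_def)
  also have "\<dots> \<le> m_rad A"
    unfolding m_rad_def v_def local_spec_rad_def[symmetric] by (rule SUP_upper) simp
  finally show "ereal (root k (path_weight A k i)) \<le> m_rad A"
    by (simp add: p_def)
qed

theorem theorem3p4:
  fixes A :: infmat
  assumes "A \<in> bounded_nonneg_mats"
  shows "cycle_mean A \<le> m_rad A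
    \<and> r_path A \<le> ereal (ess_spec_rad A)
    \<and> ereal (spec_rad A) = max (ereal (ess_spec_rad A)) (m_rad A)"
  \<comment> \<open>The equality combines the upper bound by the maximum with the facts that both
    radii in the maximum are at most \<open>spec_rad A\<close>.\<close>
  using cycle_mean_le_m_rad[OF assms] r_path_le_ess_spec_rad[OF assms] spec_rad_le_max[OF assms]
    ess_spec_rad_le_spec_rad[OF assms] m_rad_le_spec_rad[OF assms]
  by (auto intro: antisym)

end
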